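(* For every (finite, simple) graph $G$, $\pi_f(G)\le 3$; moreover $\pi_f(G)=3$ whenever $G$ contains $K_4$ as a subgraph.
   Context: Two edges of a graph are nonincident if they share no endpoint. A linear ordering of $V(G)$ separates a pair $\{e,e'\}$ of nonincident edges if both endpoints of one edge precede both endpoints of the other. For a positive integer $t$, the $t$-fold separation dimension $\pi_t(G)$ is the minimum length of a list of linear orderings of $V(G)$ (repetitions allowed) such that every pair of nonincident edges of $G$ is separated by at least $t$ orderings in the list (this is $0$ if $G$ has no pair of nonincident edges). The fractional separation dimension is $\pi_f(G)=\liminf_{t\to\infty}\pi_t(G)/t$; equivalently it is the minimum of $a/b$ such that some list of $a$ linear orderings separates every pair of nonincident edges at least $b$ times. *)

theory Defs
  imports "HOL-Analysis.Analysis" "HOL-Library.Ramsey"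
begin

locale finite_simple_graph =
  fixes V :: "'a set" and E :: "'a set set"
  assumes finite_vertices: "finite V"
    and edges: "E \<subseteq> [V]\<^bsup>2\<^esup>"

definition nonincident :: "'a set \<Rightarrow> 'a set \<Rightarrow> bool" where
  "nonincident e e' \<longleftrightarrow> e \<inter> e' = {}"

definition precedes :: "'a rel \<Rightarrow> 'a \<Rightarrow> 'a \<Rightarrow> bool" where
  "precedes r u v \<longleftrightarrow> (u, v) \<in> r \<and> u \<noteq> v"

definition separates :: "'a rel \<Rightarrow> 'a set \<Rightarrow> 'a set \<Rightarrow> bool" where
  "separates r e e' \<longleftrightarrow>
     (\<forall>u\<in>e. \<forall>v\<in>e'. precedes r u v) \<or> (\<forall>u\<in>e. \<forall>v\<in>e'. precedes r v u)"

definition separating_list :: "'a set \<Rightarrow> 'a set set \<Rightarrow> nat \<Rightarrow> 'a rel list \<Rightarrow> bool" where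
  "separating_list V E t rs \<longleftrightarrow>
     (\<forall>r\<in>set rs. linear_order_on V r) \<and>
     (\<forall>e\<in>E. \<forall>e'\<in>E. nonincident e e' \<longrightarrow> t \<le> length (filter (\<lambda>r. separates r e e') rs))"

definition sep_dim :: "nat \<Rightarrow> 'a set \<Rightarrow> 'a set set \<Rightarrow> nat" where
  "sep_dim t V E = (LEAST n. \<exists>rs. length rs = n \<and> separating_list V E t rs)"

text \<open>The limit inferior is taken in the extended reals, so that it exists without side
  conditions; its value does not depend on the term at \<open>t = 0\<close>.\<close>

definition frac_sep_dim :: "'a set \<Rightarrow> 'a set set \<Rightarrow> ereal" where
  "frac_sep_dim V E = liminf (\<lambda>t. ereal (real (sep_dim t V E) / real t))"

definition contains_K4 :: "'a set \<Rightarrow> 'a set set \<Rightarrow> bool" where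
  "contains_K4 V E \<longleftrightarrow> (\<exists>S. S \<subseteq> V \<and> card S = 4 \<and> clique S E)"

end

theory Submission
  imports Defs
begin

text \<open>Four distinct vertices can be split into two pairs in three ways, and a linear ordering
  separates exactly one of these splittings, namely the two smallest against the two largest
  vertices. Applied to a \<open>K\<^sub>4\<close>, this shows that a list separating all pairs \<open>t\<close> times has length at
  least \<open>3 t\<close>. Conversely, transposing two vertices permutes the set of all linear orderings of
  \<open>V\<close> and exchanges the splittings, so exactly a third of all orderings separates a given
  nonincident pair; repeating the list of all orderings gives \<open>\<pi>\<^sub>t(G) \<le> 3 t + |V|!\<close>.\<close>

section \<open>One ordering against the three splittings of four vertices\<close>

lemma precedes_asym: "linear_order_on V r \<Longrightarrow> precedes r x y \<Longrightarrow> \<not> precedes r y x"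
  unfolding precedes_def order_on_defs antisym_def by blast

lemma precedes_trans: "linear_order_on V r \<Longrightarrow> precedes r x y \<Longrightarrow> precedes r y z \<Longrightarrow> precedes r x z"
  unfolding precedes_def order_on_defs antisym_def trans_def by metis

lemma precedes_total:
  "linear_order_on V r \<Longrightarrow> x \<in> V \<Longrightarrow> y \<in> V \<Longrightarrow> x \<noteq> y \<Longrightarrow> precedes r x y \<or> precedes r y x"
  unfolding precedes_def order_on_defs total_on_def by blast

lemma separates_doubletons:
  "separates r {a, b} {c, d} \<longleftrightarrow>
     (precedes r a c \<and> precedes r a d \<and> precedes r b c \<and> precedes r b d) \<or>
     (precedes r c a \<and> precedes r d a \<and> precedes r c b \<and> precedes r d b)"
  unfolding separates_def by auto

text \<open>Any two splittings give contradictory constraints on two cross pairs. If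
  \<open>{a, b}\<close> is separated from \<open>{c, d}\<close>, then \<open>a\<close> precedes
  \<open>d\<close> iff \<open>b\<close> precedes \<open>c\<close>; if \<open>{a, c}\<close> is
  separated from \<open>{b, d}\<close>, then \<open>a\<close> precedes \<open>d\<close> iff
  \<open>c\<close> precedes \<open>b\<close>. Asymmetry excludes both at once, and the other two
  cases are alike.\<close>

lemma separates_at_most_one_splitting:
  assumes "linear_order_on V r"
  shows "\<not> (separates r {a, b} {c, d} \<and> separates r {a, c} {b, d})"
    and "\<not> (separates r {a, b} {c, d} \<and> separates r {a, d} {b, c})"
    and "\<not> (separates r {a, c} {b, d} \<and> separates r {a, d} {b, c})"
  using precedes_asym[OF assms] unfolding separates_doubletons by blast+

lemma separates_some_splitting:
  assumes r: "linear_order_on V r" and "{a, b, c, d} \<subseteq> V" and "distinct [a, b, c, d]"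
  shows "separates r {a, b} {c, d} \<or> separates r {a, c} {b, d} \<or> separates r {a, d} {b, c}"
proof -
  have "precedes r a b \<or> precedes r b a" "precedes r a c \<or> precedes r c a"
    "precedes r a d \<or> precedes r d a" "precedes r b c \<or> precedes r c b"
    "precedes r b d \<or> precedes r d b" "precedes r c d \<or> precedes r d c"
    using assms(2,3) by (simp_all add: precedes_total[OF r])
  \<comment> \<open>Transitivity discards the cyclic outcomes of the six comparisons; in each
    remaining outcome the two least vertices form one block of the separated splitting.\<close>
  then show ?thesis
    unfolding separates_doubletons using precedes_trans[OF r] by smt
qed

section \<open>Symmetry and the count of separating orderings\<close>

text \<open>Injectivity carries antisymmetry and totality over. The equivalence for \<open>V\<close>
  is used in both directions: elements of \<open>V\<close> stay in \<open>V\<close>, which gives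
  reflexivity and totality, and no others enter, so the pulled-back relation stays inside
  \<open>V \<times> V\<close>.\<close>

lemma linear_order_on_inv_image:
  assumes r: "linear_order_on V r" and "inj f" and f: "\<And>x. f x \<in> V \<longleftrightarrow> x \<in> V"
  shows "linear_order_on V (inv_image r f)"
proof -
  have "trans (inv_image r f)"
    using r by (simp add: order_on_defs trans_inv_image)
  moreover have "antisym (inv_image r f)"
    using r \<open>inj f\<close> by (auto simp: order_on_defs antisym_def dest: injD)
  moreover have "total_on V (inv_image r f)"
    using r \<open>inj f\<close> f by (auto simp: order_on_defs total_on_def inj_eq)
  moreover have "refl_on V (inv_image r f)"
    using r f by (auto simp: order_on_defs refl_on_def)
  moreover have "inv_image r f \<subseteq> V \<times> V"
    using r f by (auto simp: order_on_defs)
  ultimately show ?thesis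
    by (simp add: order_on_defs)
qed

lemma separates_inv_image:
  assumes "inj f"
  shows "separates (inv_image r f) e e' \<longleftrightarrow> separates r (f ` e) (f ` e')"
  using assms unfolding separates_def precedes_def by (simp add: inj_eq)

lemma finite_linear_orders: "finite V \<Longrightarrow> finite {r. linear_order_on V r}"
  by (rule finite_subset[of _ "Pow (V \<times> V)"]) (auto simp: order_on_defs refl_on_def)

text \<open>A transposition is an involution, so pulling orderings back along it is its own inverse
  and maps the two sets bijectively onto each other.\<close>

lemma card_separating_orders_transpose:
  assumes "finite V" and "x \<in> V" and "y \<in> V"
  shows "card {r. linear_order_on V r \<and> separates r e e'} =
    card {r. linear_order_on V r \<and>
      separates r (Transposition.transpose x y ` e) (Transposition.transpose x y ` e')}"
proof -
  let ?f = "Transposition.transpose x y"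
  have V: "?f z \<in> V \<longleftrightarrow> z \<in> V" for z
    using assms by (auto simp: Transposition.transpose_def)
  have inv: "inv_image (inv_image r ?f) ?f = r" for r
    by (auto simp: inv_image_def)
  have lin: "linear_order_on V (inv_image r ?f)" if "linear_order_on V r" for r
    using linear_order_on_inv_image[OF that inj_transpose V] .
  have sep: "separates (inv_image r ?f) d d' \<longleftrightarrow> separates r (?f ` d) (?f ` d')" for r d d'
    by (rule separates_inv_image[OF inj_transpose])
  have "?f ` ?f ` d = d" for d
    by (simp add: image_image)
  then have "bij_betw (\<lambda>r. inv_image r ?f) {r. linear_order_on V r \<and> separates r e e'}
      {r. linear_order_on V r \<and> separates r (?f ` e) (?f ` e')}"
    by (intro bij_betw_byWitness[where f' = "\<lambda>r. inv_image r ?f"]) (auto simp: inv sep lin)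
  then show ?thesis
    by (rule bij_betw_same_card)
qed

text \<open>Swapping \<open>b\<close> with \<open>c\<close> turns the first splitting into the
  second, and swapping \<open>b\<close> with \<open>d\<close> turns it into the third. The three
  classes thus have equal size, and they partition the set of all orderings.\<close>

lemma card_separating_orders:
  assumes V: "finite V" "{a, b, c, d} \<subseteq> V" and dist: "distinct [a, b, c, d]"
  shows "3 * card {r. linear_order_on V r \<and> separates r {a, b} {c, d}} =
    card {r. linear_order_on V r}"
proof -
  let ?S = "\<lambda>e e'. {r. linear_order_on V r \<and> separates r e e'}"
  have fin: "finite (?S e e')" for e e'
    using finite_linear_orders[OF V(1)] by (rule rev_finite_subset) auto
  have sym: "c \<noteq> b" "d \<noteq> b" "d \<noteq> c"
    using dist by auto
  have "card (?S {a, b} {c, d}) = card (?S {a, c} {b, d})"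
    using card_separating_orders_transpose[OF V(1), of b c "{a, b}" "{c, d}"] V(2) dist sym
    by (simp add: transpose_apply_other)
  moreover have "card (?S {a, b} {c, d}) = card (?S {a, d} {b, c})"
    using card_separating_orders_transpose[OF V(1), of b d "{a, b}" "{c, d}"] V(2) dist sym
    by (simp add: transpose_apply_other insert_commute[of c b])
  moreover have "card {r. linear_order_on V r} =
    card (?S {a, b} {c, d}) + card (?S {a, c} {b, d}) + card (?S {a, d} {b, c})"
  proof -
    have U: "{r. linear_order_on V r} = ?S {a, b} {c, d} \<union> ?S {a, c} {b, d} \<union> ?S {a, d} {b, c}"
      using separates_some_splitting[OF _ V(2) dist] by blast
    have "?S {a, b} {c, d} \<inter> ?S {a, c} {b, d} = {}"
      using separates_at_most_one_splitting(1)[of V _ a b c d] by blast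
    moreover have "(?S {a, b} {c, d} \<union> ?S {a, c} {b, d}) \<inter> ?S {a, d} {b, c} = {}"
      using separates_at_most_one_splitting(2,3)[where V = V and a = a and b = b and c = c and d = d]
      by blast
    ultimately show ?thesis
      unfolding U by (simp add: card_Un_disjoint fin)
  qed
  ultimately show ?thesis
    by simp
qed

section \<open>Upper bound: repeating the list of all orderings\<close>

text \<open>Used twice: with \<open>separates\<close> to count separations, and with the constantly
  true predicate to get the length of the repeated list.\<close>

lemma length_filter_concat_replicate:
  "length (filter P (concat (replicate k xs))) = k * length (filter P xs)"
  by (induction k) auto

lemma (in finite_simple_graph) card_separating_orders_edges:
  assumes "e \<in> E" and "e' \<in> E" and "nonincident e e'"
  shows "3 * card {r. linear_order_on V r \<and> separates r e e'} = card {r. linear_order_on V r}"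
proof -
  obtain a b where e: "e = {a, b}" "a \<noteq> b" "{a, b} \<subseteq> V"
    using edges assms(1) by (auto simp: nsets_def card_2_iff)
  obtain c d where e': "e' = {c, d}" "c \<noteq> d" "{c, d} \<subseteq> V"
    using edges assms(2) by (auto simp: nsets_def card_2_iff)
  have "distinct [a, b, c, d]" "{a, b, c, d} \<subseteq> V"
    using e e' assms(3) by (auto simp: nonincident_def)
  then show ?thesis
    using card_separating_orders[OF finite_vertices] e e' by blast
qed

lemma (in finite_simple_graph) separating_list_exists:
  "\<exists>rs. length rs \<le> 3 * t + card {r. linear_order_on V r} \<and> separating_list V E t rs"
proof -
  let ?L = "{r. linear_order_on V r}"
  obtain xs where xs: "set xs = ?L" "distinct xs"
    using finite_distinct_list[OF finite_linear_orders[OF finite_vertices]] by auto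
  define N where "N = card ?L"
  \<comment> \<open>One copy of \<open>xs\<close> separates each nonincident pair of edges
    \<open>N / 3\<close> times, so \<open>k * N >= 3 * t\<close> is enough. Rounding down and adding
    1 ensures this and overshoots \<open>3 * t\<close> by at most \<open>N\<close>.\<close>
  define k where "k = 3 * t div N + 1"
  define rs where "rs = concat (replicate k xs)"
  \<comment> \<open>A well-ordering of \<open>V\<close> shows that some ordering exists, so the
    division by \<open>N\<close> is a genuine one.\<close>
  obtain r0 where "linear_order_on V r0"
    using well_order_on[of V] by (auto simp: well_order_on_def)
  then have "N > 0"
    using finite_linear_orders[OF finite_vertices] by (auto simp: N_def card_gt_0_iff)
  have "3 * t = 3 * t div N * N + 3 * t mod N"
    by simp
  with \<open>N > 0\<close> have k: "3 * t \<le> k * N" "k * N \<le> 3 * t + N"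
    using mod_less_divisor[of N "3 * t"] unfolding k_def distrib_right by linarith+
  have "length xs = N"
    using xs distinct_card[of xs] by (simp add: N_def)
  then have "length rs \<le> 3 * t + N"
    using length_filter_concat_replicate[of "\<lambda>_. True" k xs] k by (simp add: rs_def)
  moreover have "t \<le> length (filter (\<lambda>r. separates r e e') rs)"
    if "e \<in> E" "e' \<in> E" "nonincident e e'" for e e'
  proof -
    have "length (filter (\<lambda>r. separates r e e') xs) =
      card {r. linear_order_on V r \<and> separates r e e'}"
      using xs distinct_card[of "filter (\<lambda>r. separates r e e') xs"] by simp
    then have "3 * length (filter (\<lambda>r. separates r e e') rs) = k * N"
      using card_separating_orders_edges[OF that]
      by (simp add: rs_def length_filter_concat_replicate N_def)
    with k show ?thesis
      by linarith
  qed
  moreover have "\<forall>r\<in>set rs. linear_order_on V r"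
    using xs by (auto simp: rs_def)
  ultimately show ?thesis
    unfolding separating_list_def N_def by blast
qed

lemma (in finite_simple_graph) sep_dim_le: "sep_dim t V E \<le> 3 * t + card {r. linear_order_on V r}"
proof -
  obtain rs where "length rs \<le> 3 * t + card {r. linear_order_on V r}" "separating_list V E t rs"
    using separating_list_exists by blast
  moreover have "sep_dim t V E \<le> length rs"
    unfolding sep_dim_def by (rule Least_le) (use calculation in blast)
  ultimately show ?thesis
    by linarith
qed

section \<open>Lower bound from a complete graph on four vertices\<close>

text \<open>Each entry is counted by at most one filter. Counting is by list positions, since a
  separating list may repeat an ordering.\<close>

lemma length_filter_disjoint3_le:
  assumes "\<And>x. x \<in> set xs \<Longrightarrow> \<not> (P x \<and> Q x) \<and> \<not> (P x \<and> R x) \<and> \<not> (Q x \<and> R x)"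
  shows "length (filter P xs) + length (filter Q xs) + length (filter R xs) \<le> length xs"
  using assms
proof (induction xs)
  case (Cons x xs)
  have "length (filter P xs) + length (filter Q xs) + length (filter R xs) \<le> length xs"
    by (rule Cons.IH) (simp add: Cons.prems)
  with Cons.prems[of x] show ?case
    by auto
qed simp

text \<open>The clique contains both edges of every splitting, so each of the three splittings
  claims \<open>t\<close> entries of the list, and no entry serves two of them.\<close>

lemma separating_list_K4_length:
  assumes "contains_K4 V E" and rs: "separating_list V E t rs"
  shows "3 * t \<le> length rs"
proof -
  obtain S where S: "card S = 4" "clique S E"
    using assms(1) by (auto simp: contains_K4_def)
  then have "finite S"
    by (metis card.infinite zero_neq_numeral)
  then obtain xs where xs: "set xs = S" "distinct xs"
    using finite_distinct_list by blast
  then have "length xs = 4"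
    using S(1) distinct_card[of xs] by simp
  then obtain a b c d where "xs = [a, b, c, d]"
    by (simp add: numeral_eq_Suc length_Suc_conv) blast
  with xs have dist: "distinct [a, b, c, d]" and abcd: "{a, b, c, d} \<subseteq> S"
    by auto
  have sym: "c \<noteq> b" "d \<noteq> b" "d \<noteq> c"
    using dist by auto
  have count: "t \<le> length (filter (\<lambda>r. separates r {w, x} {y, z}) rs)"
    if "distinct [w, x, y, z]" "{w, x, y, z} \<subseteq> S" for w x y z
  proof -
    have "{w, x} \<in> E" "{y, z} \<in> E"
      using S(2) that by (simp_all add: clique_def)
    moreover have "nonincident {w, x} {y, z}"
      using that(1) by (simp add: nonincident_def)
    ultimately show ?thesis
      using rs unfolding separating_list_def by blast
  qed
  have "t \<le> length (filter (\<lambda>r. separates r {a, b} {c, d}) rs)"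
    "t \<le> length (filter (\<lambda>r. separates r {a, c} {b, d}) rs)"
    "t \<le> length (filter (\<lambda>r. separates r {a, d} {b, c}) rs)"
    using dist sym abcd count[of a b c d] count[of a c b d] count[of a d b c] by simp_all
  moreover have "length (filter (\<lambda>r. separates r {a, b} {c, d}) rs) +
    length (filter (\<lambda>r. separates r {a, c} {b, d}) rs) +
    length (filter (\<lambda>r. separates r {a, d} {b, c}) rs) \<le> length rs"
  proof (rule length_filter_disjoint3_le)
    fix r assume "r \<in> set rs"
    then have "linear_order_on V r"
      using rs by (simp add: separating_list_def)
    then show "\<not> (separates r {a, b} {c, d} \<and> separates r {a, c} {b, d}) \<and>
      \<not> (separates r {a, b} {c, d} \<and> separates r {a, d} {b, c}) \<and>
      \<not> (separates r {a, c} {b, d} \<and> separates r {a, d} {b, c})"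
      using separates_at_most_one_splitting[where V = V and a = a and b = b and c = c and d = d]
      by blast
  qed
  ultimately show ?thesis
    by linarith
qed

text \<open>The upper bound construction shows that separating lists exist, so the
  \<open>LEAST\<close> in \<open>sep_dim\<close> is attained by an actual list, to which the length
  bound applies.\<close>

lemma (in finite_simple_graph) sep_dim_K4_ge:
  assumes "contains_K4 V E"
  shows "3 * t \<le> sep_dim t V E"
proof -
  have "\<exists>rs. length rs = sep_dim t V E \<and> separating_list V E t rs"
    unfolding sep_dim_def by (rule LeastI_ex) (use separating_list_exists in blast)
  then show ?thesis
    using separating_list_K4_length[OF assms] by metis
qed

theorem mainTheorem1:
  fixes V :: "'a set" and E :: "'a set set"
  assumes "finite_simple_graph V E"
  shows "frac_sep_dim V E \<le> 3 \<and> (contains_K4 V E \<longrightarrow> frac_sep_dim V E = 3)"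
proof -
  interpret finite_simple_graph V E
    by fact
  define N where "N = card {r. linear_order_on V r}"
  \<comment> \<open>The additive error \<open>N\<close> does not depend on \<open>t\<close>, so it
    vanishes after division by \<open>t\<close>.\<close>
  have "((\<lambda>t. 3 + real N / real t) \<longlongrightarrow> 3 + 0) sequentially"
    by (intro tendsto_intros lim_const_over_n)
  then have "liminf (\<lambda>t. ereal (3 + real N / real t)) = 3"
    by (intro lim_imp_Liminf) (simp_all add: numeral_eq_ereal)
  moreover have "real (sep_dim t V E) / real t \<le> 3 + real N / real t" if "t > 0" for t
  proof -
    have "real (sep_dim t V E) \<le> 3 * real t + real N"
      using sep_dim_le[of t] unfolding N_def by linarith
    with that show ?thesis
      by (simp add: field_simps)
  qed
  then have "liminf (\<lambda>t. ereal (real (sep_dim t V E) / real t)) \<le>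
      liminf (\<lambda>t. ereal (3 + real N / real t))"
    by (intro Liminf_mono eventually_mono[OF eventually_gt_at_top[of 0]]) simp
  ultimately have upper: "frac_sep_dim V E \<le> 3"
    by (simp add: frac_sep_dim_def)
  moreover have "3 \<le> frac_sep_dim V E" if K4: "contains_K4 V E"
    unfolding frac_sep_dim_def
  proof (rule Liminf_bounded)
    \<comment> \<open>At \<open>t = 0\<close> the quotient is 0 by the convention for division by
      zero, so the bound is claimed only for positive \<open>t\<close>; the limit inferior ignores
      that one term.\<close>
    have "3 \<le> ereal (real (sep_dim t V E) / real t)" if "t > 0" for t
    proof -
      have "3 * real t \<le> real (sep_dim t V E)"
        using sep_dim_K4_ge[OF K4, of t] by linarith
      with that have "3 \<le> real (sep_dim t V E) / real t"
        by (simp add: field_simps)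
      then show ?thesis
        by (simp add: numeral_eq_ereal)
    qed
    then show "\<forall>\<^sub>F t in sequentially. 3 \<le> ereal (real (sep_dim t V E) / real t)"
      by (intro eventually_mono[OF eventually_gt_at_top[of 0]])
  qed
  ultimately show ?thesis
    by (auto intro: antisym)
qed

end
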